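(* Let $\theta\in(0,\pi)$ with $\cos\theta=s/r$, where $r,s\in\mathbb{Z}$, $0\le|s|<r$, $\gcd(r,s)=1$. A natural number $n$ belongs to $\mathcal{N}_\theta$ if and only if the system $$E_\theta^w:\ y^2=x(x+(r+s)w)(x-(r-s)w),\qquad F_\theta^N:\ v^2=u(u-(r+s)N)(u+(r-s)N),\qquad C_R:\ xv=uy,$$ where $N=2n-w$, has a rational solution $(u,v,w,x,y)$ with $yv\neq 0$ and $0<w\le n$.
   Context: $\mathcal{N}_\theta$ denotes the set of natural numbers $n$ for which there exist positive rationals $a,b,c,d,e$ with $a^2+b^2-\frac{2s}{r}ab=c^2$, $a^2+d^2+\frac{2s}{r}ad=e^2$, and $a(b+d)=rn$. *)

theory Defs
  imports Complex_Main
begin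

text \<open>The set N_theta, where cos theta = s/r. It depends on theta only through r and s.
  n is in N_theta iff there are positive rationals a,b,c,d,e with
  a^2+b^2-(2s/r)ab = c^2, a^2+d^2+(2s/r)ad = e^2 and a(b+d) = r n.\<close>
definition N_theta :: "int \<Rightarrow> int \<Rightarrow> nat set" where
  "N_theta r s = {n. \<exists>a b c d e :: rat. a > 0 \<and> b > 0 \<and> c > 0 \<and> d > 0 \<and> e > 0 \<and>
      a^2 + b^2 - (2 * of_int s / of_int r) * a * b = c^2 \<and>
      a^2 + d^2 + (2 * of_int s / of_int r) * a * d = e^2 \<and>
      a * (b + d) = of_int r * of_nat n}"

end

theory Submission
  imports Defs "HOL-Computational_Algebra.Primes"
begin

text \<open>A solution of the system gives a triangle side a = |y/x|/2 that is common to both curves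
  because of x v = u y; the other sides are b = r w/(2a) and d = r N/(2a).
  Conversely, half-angle parameters z = (a+b+c)/(a+c-b) and q = (a+e-d)/(a+e+d) turn the data of
  N_theta into rational points of the surface h^2 = 2n zq (z-q) ((r-s) zq + (r+s)), and each such
  point in a suitable range gives a solution of the system, except that w \<le> n may fail
  (it means b \<le> d). To enforce w \<le> n we move the point. On the fibre where p = zq is constant,
  a curve Y^2 = d (z^3 - p z), the point has infinite order, so z can be made arbitrarily large.
  For large z the point (z, q) has w \<le> n if (r-s) p < r+s, and its mirror image (-q, -z) has
  w \<le> n if (r-s) p > r+s. The exceptional fibre (r-s) p = r+s is left first by
  a doubling on the elliptic curve where q is constant.\<close>

section \<open>The 2-adic valuation on the rationals\<close>

text \<open>At 0 the value is 0 rather than infinity, so the rules below assume nonzero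
  arguments.\<close>

definition v2 :: "rat \<Rightarrow> int" where
  "v2 x = int (multiplicity 2 (fst (quotient_of x))) - int (multiplicity 2 (snd (quotient_of x)))"

lemma v2_of_int_divide:
  fixes a b :: int
  assumes "a \<noteq> 0" "b \<noteq> 0"
  shows "v2 (of_int a / of_int b) = int (multiplicity 2 a) - int (multiplicity 2 b)"
proof -
  obtain c d where q: "quotient_of (of_int a / of_int b) = (c, d)" by fastforce
  have d: "d > 0" using quotient_of_denom_pos[OF q] .
  have eq: "(of_int a / of_int b :: rat) = of_int c / of_int d" using quotient_of_div[OF q] .
  hence c: "c \<noteq> 0" using assms d by auto
  from eq have "(of_int (a * d) :: rat) = of_int (c * b)"
    using assms d by (simp add: field_simps)
  hence "a * d = c * b" by (simp only: of_int_eq_iff)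
  hence "multiplicity 2 (a * d) = multiplicity 2 (c * b)" by simp
  hence "multiplicity 2 a + multiplicity 2 d = multiplicity 2 c + multiplicity 2 b"
    using assms c d by (simp add: prime_elem_multiplicity_mult_distrib)
  thus ?thesis by (simp add: v2_def q)
qed

lemma rat_fractionE:
  fixes x :: rat
  assumes "x \<noteq> 0"
  obtains a b :: int where "a \<noteq> 0" "b \<noteq> 0" "x = of_int a / of_int b"
  using assms quotient_of_div[of x] quotient_of_denom_pos[of x]
  by (metis div_0 less_irrefl of_int_0 surj_pair)

lemma v2_mult:
  assumes "x \<noteq> 0" "y \<noteq> 0"
  shows "v2 (x * y) = v2 x + v2 y"
proof -
  obtain a b where x: "a \<noteq> 0" "b \<noteq> 0" "x = of_int a / of_int b" using rat_fractionE assms by metis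
  obtain c d where y: "c \<noteq> 0" "d \<noteq> 0" "y = of_int c / of_int d" using rat_fractionE assms by metis
  have "x * y = of_int (a * c) / of_int (b * d)" using x y by simp
  thus ?thesis using x y v2_of_int_divide[of "a * c" "b * d"]
    by (simp add: v2_of_int_divide prime_elem_multiplicity_mult_distrib del: of_int_mult)
qed

lemma v2_divide:
  assumes "x \<noteq> 0" "y \<noteq> 0"
  shows "v2 (x / y) = v2 x - v2 y"
  using v2_mult[of "x / y" y] assms by simp

lemma v2_power2: "x \<noteq> 0 \<Longrightarrow> v2 (x\<^sup>2) = 2 * v2 x"
  by (simp add: power2_eq_square v2_mult)

lemma v2_2: "v2 2 = 1"
  using v2_of_int_divide[of 2 1] by simp

lemma v2_minus: "x \<noteq> 0 \<Longrightarrow> v2 (- x) = v2 x"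
proof -
  assume "x \<noteq> 0"
  moreover have "v2 (- 1) = 0"
    using v2_of_int_divide[of "-1" 1] by (simp add: multiplicity_unit_right)
  ultimately show ?thesis using v2_mult[of "-1" x] by simp
qed

lemma rat_common_denominatorE:
  fixes x y :: rat
  assumes "x \<noteq> 0" "y \<noteq> 0"
  obtains a b c :: int where "a \<noteq> 0" "b \<noteq> 0" "c \<noteq> 0" "x = of_int a / of_int c" "y = of_int b / of_int c"
proof -
  obtain a b where x: "a \<noteq> 0" "b \<noteq> 0" "x = of_int a / of_int b" using rat_fractionE assms by metis
  obtain c d where y: "c \<noteq> 0" "d \<noteq> 0" "y = of_int c / of_int d" using rat_fractionE assms by metis
  show thesis
    by (rule that[of "a * d" "c * b" "b * d"]) (use x y in auto)
qed

text \<open>The equality case of the ultrametric inequality, reduced to integers by a common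
  denominator.\<close>

lemma v2_add_less:
  assumes "x \<noteq> 0" "y \<noteq> 0" "v2 x < v2 y"
  shows "v2 (x + y) = v2 x"
proof -
  obtain a b c where *: "a \<noteq> 0" "b \<noteq> 0" "c \<noteq> 0" "x = of_int a / of_int c" "y = of_int b / of_int c"
    using rat_common_denominatorE assms(1,2) by metis
  have lt: "multiplicity 2 a < multiplicity 2 b"
    using assms(3) * by (simp add: v2_of_int_divide)
  have m: "multiplicity 2 (a + b) = multiplicity 2 a"
    using multiplicity_sum_lt[of 2 a b] lt * by auto
  have "a + b \<noteq> 0"
  proof
    assume "a + b = 0"
    hence "a dvd b" "b dvd a" by (simp_all add: eq_neg_iff_add_eq_0[symmetric])
    hence "multiplicity 2 b \<le> multiplicity 2 a"
      using * by (intro dvd_imp_multiplicity_le) auto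
    thus False using lt by simp
  qed
  moreover have "x + y = of_int (a + b) / of_int c" using * by (simp add: add_divide_distrib)
  ultimately show ?thesis
    using * m v2_of_int_divide[of "a + b" c] v2_of_int_divide[of a c] by auto
qed

text \<open>Once the common power of 2 is taken out, two odd numbers remain, and their sum is
  even.\<close>

lemma v2_add_eq:
  assumes "x \<noteq> 0" "y \<noteq> 0" "x + y \<noteq> 0" "v2 x = v2 y"
  shows "v2 (x + y) > v2 x"
proof -
  obtain a b c where *: "a \<noteq> 0" "b \<noteq> 0" "c \<noteq> 0" "x = of_int a / of_int c" "y = of_int b / of_int c"
    using rat_common_denominatorE assms(1,2) by metis
  have eq: "multiplicity 2 a = multiplicity 2 b"
    using assms(4) * by (simp add: v2_of_int_divide)
  have s: "x + y = of_int (a + b) / of_int c" using * by (simp add: add_divide_distrib)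
  hence ab: "a + b \<noteq> 0" using assms(3) by auto
  obtain a' where a': "a = 2 ^ multiplicity 2 a * a'" "\<not> 2 dvd a'"
    using multiplicity_decompose'[of a 2] * by auto
  obtain b' where b': "b = 2 ^ multiplicity 2 b * b'" "\<not> 2 dvd b'"
    using multiplicity_decompose'[of b 2] * by auto
  have "a + b = 2 ^ multiplicity 2 a * (a' + b')"
    using a'(1) b'(1) eq by (metis distrib_left)
  moreover have "2 dvd a' + b'" using a'(2) b'(2) by simp
  ultimately have "2 ^ Suc (multiplicity 2 a) dvd a + b"
    by (metis mult_dvd_mono dvd_refl power_Suc2)
  hence "Suc (multiplicity 2 a) \<le> multiplicity 2 (a + b)"
    using ab by (intro multiplicity_geI) auto
  thus ?thesis using s * ab v2_of_int_divide[of "a + b" c] v2_of_int_divide[of a c] by simp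
qed

text \<open>For nonzero \<open>y\<close> the valuation of the left side is even and that of the
  right side odd. This later excludes torsion coincidences in the doublings.\<close>

lemma rat_sqrt2_irrational:
  fixes x y :: rat
  assumes "x\<^sup>2 = 2 * y\<^sup>2"
  shows "y = 0"
proof (rule ccontr)
  assume y: "y \<noteq> 0"
  hence "x \<noteq> 0" using assms by auto
  hence "2 * v2 x = 1 + 2 * v2 y"
    using y assms v2_power2[of x] v2_power2[of y] v2_mult[of 2 "y\<^sup>2"] v2_2 by simp
  thus False by presburger
qed

section \<open>Doubling on the curves Y^2 = d (z^3 - p z)\<close>

text \<open>For positive \<open>d\<close> and \<open>p\<close> these are the z-coordinates of the
  rational points on the unbounded real branch, without its 2-torsion point.\<close>

definition curve_points :: "rat \<Rightarrow> rat \<Rightarrow> rat set" where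
  "curve_points d p = {z. z > 0 \<and> z\<^sup>2 > p \<and> (\<exists>Y. Y\<^sup>2 = d * (z ^ 3 - p * z))}"

text \<open>The z-coordinate of twice a point; the factor \<open>d\<close> cancels from the
  duplication formula.\<close>

definition double :: "rat \<Rightarrow> rat \<Rightarrow> rat" where
  "double p z = (z\<^sup>2 + p)\<^sup>2 / (4 * z * (z\<^sup>2 - p))"

lemma double_mem:
  assumes d: "d > 0" and p: "p > 0" and z: "z \<in> curve_points d p"
  shows "double p z \<in> curve_points d p"
proof -
  obtain Y where z0: "z > 0" "z\<^sup>2 > p" and Y: "Y\<^sup>2 = d * (z ^ 3 - p * z)"
    using z unfolding curve_points_def by auto
  define T where "T = z * (z\<^sup>2 - p)"
  define W where "W = z\<^sup>2 + p"
  define U where "U = z ^ 4 - 6 * p * z\<^sup>2 + p\<^sup>2"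
  have T: "T > 0" using z0 by (simp add: T_def)
  have W: "W > 0" using z0 p by (simp add: W_def add_pos_pos)
  have dz: "double p z = W\<^sup>2 / (4 * T)" by (simp add: double_def W_def T_def mult.assoc)
  have YT: "Y\<^sup>2 = d * T" unfolding Y T_def by algebra
  have WU: "W ^ 4 - 16 * p * T\<^sup>2 = U\<^sup>2" unfolding W_def T_def U_def by algebra
  have U: "U \<noteq> 0"
  proof
    \<comment> \<open>Completing the square turns \<open>U\<close> into (z^2 - 3p)^2 - 8p^2.\<close>
    assume "U = 0"
    hence "(z\<^sup>2 - 3 * p)\<^sup>2 = 2 * (2 * p)\<^sup>2" unfolding U_def by algebra
    from rat_sqrt2_irrational[OF this] p show False by simp
  qed
  have q: "(double p z)\<^sup>2 - p = U\<^sup>2 / (16 * T\<^sup>2)"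
  proof -
    have "(double p z)\<^sup>2 - p = (W ^ 4 - 16 * p * T\<^sup>2) / (16 * T\<^sup>2)"
      unfolding dz using T by (simp add: diff_divide_distrib power_divide power_mult_distrib flip: power_mult)
    thus ?thesis unfolding WU .
  qed
  have "(double p z)\<^sup>2 - p > 0" unfolding q using U T by simp
  moreover have "double p z > 0" unfolding dz using W T by simp
  moreover have "(Y * W * U / (8 * T\<^sup>2))\<^sup>2 = d * (double p z ^ 3 - p * double p z)"
  proof -
    have "double p z ^ 3 - p * double p z = double p z * ((double p z)\<^sup>2 - p)" by algebra
    also have "\<dots> = W\<^sup>2 / (4 * T) * (U\<^sup>2 / (16 * T\<^sup>2))" by (simp only: q) (simp only: dz)
    finally have "d * (double p z ^ 3 - p * double p z) = d * (W\<^sup>2 / (4 * T) * (U\<^sup>2 / (16 * T\<^sup>2)))" by simp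
    also have "\<dots> = (d * T) * W\<^sup>2 * U\<^sup>2 / (64 * T ^ 4)"
      using T by (simp add: power2_eq_square power4_eq_xxxx)
    also have "\<dots> = (Y * W * U / (8 * T\<^sup>2))\<^sup>2"
      unfolding YT[symmetric] by (simp add: power_divide power_mult_distrib)
    finally show ?thesis ..
  qed
  ultimately show ?thesis unfolding curve_points_def by auto
qed

lemma v2_double:
  assumes p: "p > 0" and z: "z > 0" "z\<^sup>2 > p"
  shows "v2 (double p z) = 2 * v2 (z\<^sup>2 + p) - 2 - v2 z - v2 (z\<^sup>2 - p)"
proof -
  have *: "z\<^sup>2 + p \<noteq> 0" "z\<^sup>2 - p \<noteq> 0" "z \<noteq> 0"
    using assms by (auto simp: add_pos_pos)
  have "v2 4 = 2" using v2_mult[of 2 2] v2_2 by simp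
  thus ?thesis unfolding double_def using *
    by (simp add: v2_divide v2_mult v2_power2)
qed

text \<open>Here z^2 dominates \<open>p\<close> 2-adically, so both z^2 + p and z^2 - p have
  valuation 2 \<open>v2 z\<close>. The hypothesis persists under doubling, hence the valuation falls
  forever.\<close>

lemma v2_double_large:
  assumes p: "p > 0" and z: "z > 0" "z\<^sup>2 > p" and v: "2 * v2 z < v2 p"
  shows "v2 (double p z) = v2 z - 2"
proof -
  have *: "z\<^sup>2 \<noteq> 0" "p \<noteq> 0" "v2 (z\<^sup>2) < v2 p" using assms by (auto simp: v2_power2)
  have "v2 (z\<^sup>2 + p) = 2 * v2 z" using v2_add_less[OF *] z by (simp add: v2_power2)
  moreover have "v2 (z\<^sup>2 - p) = 2 * v2 z"
    using v2_add_less[of "z\<^sup>2" "- p"] * z by (simp add: v2_power2 v2_minus)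
  ultimately show ?thesis using v2_double[OF p z] by simp
qed

text \<open>Here \<open>p\<close> dominates z^2, and a single doubling leads into the case of
  \<open>v2_double_large\<close>.\<close>

lemma v2_double_small:
  assumes p: "p > 0" and z: "z > 0" "z\<^sup>2 > p" and v: "2 * v2 z > v2 p"
  shows "2 * v2 (double p z) < v2 p"
proof -
  have *: "p \<noteq> 0" "z\<^sup>2 \<noteq> 0" "v2 p < v2 (z\<^sup>2)" using assms by (auto simp: v2_power2)
  have "v2 (z\<^sup>2 + p) = v2 p" using v2_add_less[OF *] by (simp add: add.commute)
  moreover have "v2 (z\<^sup>2 - p) = v2 p"
    using v2_add_less[of "- p" "z\<^sup>2"] * by (simp add: v2_minus)
  ultimately show ?thesis using v2_double[OF p z] v by simp
qed

text \<open>Of the numbers z^2 + p and z^2 - p exactly one gains a single factor 2, since they add up to 2 z^2.\<close>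

lemma v2_double_balanced:
  assumes p: "p > 0" and z: "z > 0" "z\<^sup>2 > p" and v: "2 * v2 z = v2 p"
  shows "2 * v2 (double p z) \<noteq> v2 p"
proof -
  have nz: "z \<noteq> 0" "z\<^sup>2 \<noteq> 0" "p \<noteq> 0" "z\<^sup>2 + p \<noteq> 0" "z\<^sup>2 - p \<noteq> 0" "2 * z\<^sup>2 \<noteq> 0"
    using assms by (auto simp: add_pos_pos)
  have vz: "v2 (z\<^sup>2) = v2 p" using nz v by (simp add: v2_power2)
  have i: "v2 (z\<^sup>2 + p) > v2 p" using v2_add_eq[of "z\<^sup>2" p] nz vz by simp
  have j: "v2 (z\<^sup>2 - p) > v2 p" using v2_add_eq[of "z\<^sup>2" "- p"] nz vz by (simp add: v2_minus)
  have s: "v2 (2 * z\<^sup>2) = v2 p + 1" using v2_mult[of 2 "z\<^sup>2"] nz vz v2_2 by simp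
  have e: "(z\<^sup>2 + p) + (z\<^sup>2 - p) = 2 * z\<^sup>2" "(z\<^sup>2 - p) + (z\<^sup>2 + p) = 2 * z\<^sup>2" by simp_all
  consider "v2 (z\<^sup>2 + p) < v2 (z\<^sup>2 - p)" | "v2 (z\<^sup>2 - p) < v2 (z\<^sup>2 + p)"
    | "v2 (z\<^sup>2 + p) = v2 (z\<^sup>2 - p)" by linarith
  thus ?thesis
  proof cases
    case 1
    hence "v2 (z\<^sup>2 + p) = v2 p + 1" using v2_add_less[of "z\<^sup>2 + p" "z\<^sup>2 - p"] nz e s by simp
    thus ?thesis using v2_double[OF p z] 1 v by simp
  next
    case 2
    hence "v2 (z\<^sup>2 - p) = v2 p + 1" using v2_add_less[of "z\<^sup>2 - p" "z\<^sup>2 + p"] nz e s by simp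
    thus ?thesis using v2_double[OF p z] 2 v by simp
  next
    case 3
    have "v2 (2 * z\<^sup>2) > v2 (z\<^sup>2 + p)" using v2_add_eq[of "z\<^sup>2 + p" "z\<^sup>2 - p"] nz e 3 by simp
    thus ?thesis using i s by simp
  qed
qed

text \<open>At most two doublings lead into the set \<open>L\<close>, on which each further doubling
  lowers \<open>v2\<close> by 2. A finite \<open>L\<close> would contain a point of least
  valuation.\<close>

lemma infinite_curve_points:
  assumes d: "d > 0" and p: "p > 0" and z: "z \<in> curve_points d p"
  shows "infinite (curve_points d p)"
proof
  assume fin: "finite (curve_points d p)"
  define L where "L = {x \<in> curve_points d p. 2 * v2 x < v2 p}"
  have pos: "x > 0" "x\<^sup>2 > p" if "x \<in> curve_points d p" for x
    using that by (auto simp: curve_points_def)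
  have small: "\<exists>x. x \<in> L" if "x \<in> curve_points d p" "2 * v2 x > v2 p" for x
    using that double_mem[OF d p] v2_double_small[OF p] pos unfolding L_def by blast
  have unbalanced: "\<exists>x. x \<in> L" if "x \<in> curve_points d p" "2 * v2 x \<noteq> v2 p" for x
    using that small by (cases "2 * v2 x < v2 p") (auto simp: L_def)
  have "\<exists>x. x \<in> L"
    using unbalanced z double_mem[OF d p z] v2_double_balanced[OF p pos[OF z]] by blast
  moreover have "finite L" using fin by (simp add: L_def)
  ultimately obtain x where x: "x \<in> L" "\<And>y. y \<in> L \<Longrightarrow> v2 x \<le> v2 y"
    by (metis arg_min_if_finite(1) arg_min_least empty_iff)
  have "v2 (double p x) = v2 x - 2"
    using x(1) v2_double_large[OF p] pos by (auto simp: L_def)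
  moreover from this have "double p x \<in> L"
    using x(1) double_mem[OF d p] by (auto simp: L_def)
  ultimately show False using x(2)[of "double p x"] by simp
qed

section \<open>Arbitrarily large points on these curves\<close>

text \<open>Pigeonhole principle on the cells of length \<epsilon> that cover the interval from 0 to
  \<open>M\<close>.\<close>

lemma infinite_bounded_close:
  fixes S :: "rat set"
  assumes "infinite S" "\<And>x. x \<in> S \<Longrightarrow> 0 \<le> x \<and> x \<le> M" "\<epsilon> > 0"
  obtains x y where "x \<in> S" "y \<in> S" "y < x" "x - y < \<epsilon>"
proof -
  define k where "k = (\<lambda>x::rat. \<lfloor>x / \<epsilon>\<rfloor>)"
  have "k ` S \<subseteq> {0..\<lfloor>M / \<epsilon>\<rfloor>}"
    unfolding k_def using assms by (auto intro!: floor_mono divide_right_mono)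
  hence "finite (k ` S)" using finite_subset by blast
  hence "\<not> inj_on k S" using assms(1) finite_imageD by blast
  then obtain x y where xy: "x \<in> S" "y \<in> S" "k x = k y" "y < x"
    unfolding inj_on_def by (metis linorder_neqE)
  have "x / \<epsilon> < of_int (k x) + 1" "of_int (k y) \<le> y / \<epsilon>" unfolding k_def by linarith+
  hence "x / \<epsilon> - y / \<epsilon> < 1" using xy(3) by simp
  hence "x - y < \<epsilon>" using assms(3) by (simp add: field_simps)
  with xy that show thesis by blast
qed

text \<open>The chord joins a point above the axis to one below it. If \<open>x\<close> and
  \<open>y\<close> are close it is therefore steep, and its third intersection with the curve lies
  far out.\<close>

lemma chord_mem:
  assumes d: "d > 0" and p: "p > 0"
    and x: "x \<in> curve_points d p" and y: "y \<in> curve_points d p" and "y < x"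
  obtains z Y where "Y\<^sup>2 = d * (z ^ 3 - p * z)" "z \<ge> p / (x - y) - x - y"
proof -
  obtain X where X: "X\<^sup>2 = d * (x ^ 3 - p * x)" and x0: "x > 0" "x\<^sup>2 > p"
    using x by (auto simp: curve_points_def)
  obtain Y where Y: "Y\<^sup>2 = d * (y ^ 3 - p * y)" and y0: "y > 0" "y\<^sup>2 > p"
    using y by (auto simp: curve_points_def)
  define X' where "X' = \<bar>X\<bar>"
  define Y' where "Y' = - \<bar>Y\<bar>"
  have X': "X'\<^sup>2 = d * (x ^ 3 - p * x)" "X' \<ge> 0" using X by (auto simp: X'_def)
  have Y': "Y'\<^sup>2 = d * (y ^ 3 - p * y)" "Y' \<le> 0" using Y by (auto simp: Y'_def)
  define l where "l = (X' - Y') / (x - y)"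
  \<comment> \<open>By Vieta, the three intersections of a line of slope \<open>l\<close> with the
    curve have z-coordinates with sum l^2 / d.\<close>
  define z where "z = l\<^sup>2 / d - x - y"
  have l: "l * (x - y) = X' - Y'" using \<open>y < x\<close> by (simp add: l_def)
  have z: "d * (z + x + y) = l\<^sup>2" using d by (simp add: z_def)
  \<comment> \<open>The cubic for the intersections with the chord, divided by its known factor t -
    x.\<close>
  define H where "H = (\<lambda>t. d * (t\<^sup>2 + t * x + x\<^sup>2 - p) - 2 * X' * l - l\<^sup>2 * (t - x))"
  have GH: "d * (t ^ 3 - p * t) - (X' + l * (t - x))\<^sup>2 = (t - x) * H t" for t
    using X'(1) unfolding H_def by algebra
  have "X' + l * (y - x) = Y'" using l by (simp add: algebra_simps)
  hence "(y - x) * H y = 0" using GH[of y] Y'(1) by simp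
  hence "H y = 0" using \<open>y < x\<close> by simp
  moreover have "H z - H y = (z - y) * (d * (z + x + y) - l\<^sup>2)" unfolding H_def by algebra
  ultimately have "H z = 0" using z by simp
  hence on: "(X' + l * (z - x))\<^sup>2 = d * (z ^ 3 - p * z)" using GH[of z] by simp
  have "X' / (x - y) \<le> l" unfolding l_def using Y'(2) \<open>y < x\<close> by (intro divide_right_mono) auto
  hence "(X' / (x - y))\<^sup>2 \<le> l\<^sup>2" using X'(2) \<open>y < x\<close> by (intro power_mono) auto
  hence "(X' / (x - y))\<^sup>2 / d \<le> l\<^sup>2 / d" using d by (simp add: divide_right_mono)
  moreover have "(X' / (x - y))\<^sup>2 / d = x * (x\<^sup>2 - p) / (x - y)\<^sup>2"
  proof -
    have "X'\<^sup>2 = d * (x * (x\<^sup>2 - p))" unfolding X'(1) by algebra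
    thus ?thesis using d by (simp add: power_divide)
  qed
  moreover have "x * (x\<^sup>2 - p) / (x - y)\<^sup>2 \<ge> p / (x - y)"
  proof -
    \<comment> \<open>Since y^2 > p, the factor x^2 - p is at least x^2 - y^2, which is at least x
      (x - y). One factor x - y of the denominator thus cancels, and x^2 > p finishes the
      bound.\<close>
    have "x * (x - y) \<le> (x + y) * (x - y)" using y0 \<open>y < x\<close> by (intro mult_right_mono) auto
    also have "\<dots> = x\<^sup>2 - y\<^sup>2" by algebra
    also have "\<dots> \<le> x\<^sup>2 - p" using y0 by simp
    finally have "x * (x * (x - y)) \<le> x * (x\<^sup>2 - p)" using x0 by (intro mult_left_mono) auto
    moreover have "p * (x - y) \<le> x * (x * (x - y))"
      using x0 \<open>y < x\<close> by (simp add: power2_eq_square mult_right_mono flip: mult.assoc)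
    ultimately have "p * (x - y) / (x - y)\<^sup>2 \<le> x * (x\<^sup>2 - p) / (x - y)\<^sup>2"
      by (intro divide_right_mono) auto
    thus ?thesis using \<open>y < x\<close> by (simp add: power2_eq_square)
  qed
  ultimately have "z \<ge> p / (x - y) - x - y" unfolding z_def by linarith
  with on show thesis by (rule that)
qed

text \<open>Two points of an infinite bounded set can be chosen close together, and their difference
  in the group law is then close to the point at infinity.\<close>

lemma curve_points_unbounded:
  assumes d: "d > 0" and p: "p > 0" and z: "z \<in> curve_points d p"
  shows "\<exists>x \<in> curve_points d p. x > M"
proof (rule ccontr)
  assume "\<not> ?thesis"
  hence le: "x \<le> M" if "x \<in> curve_points d p" for x using that by force
  have M: "M > 0" using le[OF z] z by (auto simp: curve_points_def)
  \<comment> \<open>Chosen so that p / \<epsilon> - 2 M = M + p + 1, which exceeds \<open>M\<close>,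
    \<open>p\<close> and 1; the last two put the new point on the unbounded branch.\<close>
  define \<epsilon> where "\<epsilon> = p / (3 * M + p + 1)"
  have \<epsilon>: "\<epsilon> > 0" using M p by (simp add: \<epsilon>_def)
  have "0 \<le> x \<and> x \<le> M" if "x \<in> curve_points d p" for x
    using le[OF that] that by (auto simp: curve_points_def)
  then obtain x y where xy: "x \<in> curve_points d p" "y \<in> curve_points d p" "y < x" "x - y < \<epsilon>"
    using infinite_bounded_close[OF infinite_curve_points[OF d p z] _ \<epsilon>] by metis
  obtain w Y where w: "Y\<^sup>2 = d * (w ^ 3 - p * w)" "w \<ge> p / (x - y) - x - y"
    using chord_mem[OF d p xy(1-3)] by metis
  have "p / \<epsilon> \<le> p / (x - y)" using xy p by (intro divide_left_mono) auto
  moreover have "p / \<epsilon> = 3 * M + p + 1" using p M by (simp add: \<epsilon>_def)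
  ultimately have big: "w \<ge> M + p + 1" using w(2) le[OF xy(1)] le[OF xy(2)] by linarith
  have "p < w" "1 < w" using big M p by linarith+
  hence "p * 1 < w * w" using p by (intro mult_strict_mono) auto
  hence "w\<^sup>2 > p" by (simp add: power2_eq_square)
  hence "w \<in> curve_points d p" using w(1) \<open>1 < w\<close> unfolding curve_points_def by auto
  thus False using le[of w] big p by linarith
qed

section \<open>Moving points on the surface\<close>

text \<open>The parameters \<open>B\<close> and \<open>D\<close> stand for r - s and r + s.\<close>

definition on_surface :: "rat \<Rightarrow> rat \<Rightarrow> rat \<Rightarrow> rat \<Rightarrow> rat \<Rightarrow> bool" where
  "on_surface B D n z q \<longleftrightarrow>
     0 < q \<and> q < z \<and> (\<exists>h. h\<^sup>2 = 2 * n * (z * q) * (z - q) * (B * (z * q) + D))"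

text \<open>With p = z q fixed, multiplying \<open>h\<close> by \<open>z\<close> turns the surface
  equation into Y^2 = d (z^3 - p z).\<close>

lemma on_surface_unbounded:
  assumes pos: "B > 0" "D > 0" "n > 0" and S: "on_surface B D n z q"
  shows "\<exists>x. x > M \<and> on_surface B D n x (z * q / x)"
proof -
  obtain h where zq: "0 < q" "q < z" and h: "h\<^sup>2 = 2 * n * (z * q) * (z - q) * (B * (z * q) + D)"
    using S by (auto simp: on_surface_def)
  define p where "p = z * q"
  define d where "d = 2 * n * p * (B * p + D)"
  have p: "p > 0" using zq by (simp add: p_def)
  have d: "d > 0" using p pos by (simp add: d_def add_pos_pos)
  have "(h * z)\<^sup>2 = d * (z ^ 3 - p * z)" using h unfolding d_def p_def by algebra
  moreover have "z\<^sup>2 > p" using zq unfolding p_def by (simp add: power2_eq_square)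
  ultimately have "z \<in> curve_points d p" using zq by (auto simp: curve_points_def)
  from curve_points_unbounded[OF d p this, of M] obtain x Y
    where x: "x > M" "x > 0" "x\<^sup>2 > p" and Y: "Y\<^sup>2 = d * (x ^ 3 - p * x)"
    by (auto simp: curve_points_def)
  have "(Y / x)\<^sup>2 = d * (x - p / x)"
    using Y x(2) by (simp add: power_divide power3_eq_cube power2_eq_square field_simps)
  moreover have "p / x < x" using x by (simp add: pos_divide_less_eq power2_eq_square)
  moreover have "x * (p / x) = p" using x by simp
  ultimately have "on_surface B D n x (p / x)"
    using p x(2) unfolding on_surface_def d_def
    by (intro conjI exI[of _ "Y / x"]) (simp_all only: mult_ac divide_pos_pos)
  with x(1) show ?thesis unfolding p_def by blast
qed

text \<open>The value x is the first coordinate of twice the point z on the curve where q is constant;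
  for z = 3 q that double is a point of order 2.\<close>

lemma surface_move:
  assumes zq: "0 < q" "q < z" "z \<noteq> 3 * q" and D: "D = B * (z * q)"
    and pos: "B > 0" and g: "g\<^sup>2 = n * B * (z - q)"
  shows "\<exists>x. on_surface B D n x q \<and> B * (x * q) \<noteq> D"
proof -
  define t where "t = z - q"
  have t: "t > 0" using zq by (simp add: t_def)
  define x where "x = (z + q)\<^sup>2 / (8 * t)"
  have xt: "8 * t * x = (z + q)\<^sup>2" using t by (simp add: x_def)
  have "8 * t * (x - q) = (z - 3 * q)\<^sup>2" using xt unfolding t_def by algebra
  hence xq: "x - q = (z - 3 * q)\<^sup>2 / (8 * t)" using t by (simp add: field_simps)
  have "8 * t * (x + z) = (3 * z - q)\<^sup>2" using xt unfolding t_def by algebra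
  hence xz: "x + z = (3 * z - q)\<^sup>2 / (8 * t)" using t by (simp add: field_simps)
  have "x - q > 0" unfolding xq using zq t by simp
  moreover have "2 * n * (x * q) * (x - q) * (B * (x * q) + D)
      = (q * (z + q) * (z - 3 * q) * (3 * z - q) * g / (16 * t\<^sup>2))\<^sup>2"
  proof -
    \<comment> \<open>On the exceptional fibre B x q + D = B q (x + z), so constant \<open>q\<close>
      gives a cubic with roots 0, q and -z.\<close>
    have "2 * n * (x * q) * (x - q) * (B * (x * q) + D) = 2 * n * B * q\<^sup>2 * (x * (x - q) * (x + z))"
      unfolding D by algebra
    also have "x * (x - q) * (x + z)
        = (z + q)\<^sup>2 / (8 * t) * ((z - 3 * q)\<^sup>2 / (8 * t)) * ((3 * z - q)\<^sup>2 / (8 * t))"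
      by (simp only: xq xz) (simp only: x_def)
    also have "2 * n * B * q\<^sup>2 * \<dots>
        = q\<^sup>2 * (z + q)\<^sup>2 * (z - 3 * q)\<^sup>2 * (3 * z - q)\<^sup>2 * (n * B * t) / (16 * t\<^sup>2)\<^sup>2"
      using t by (simp add: power2_eq_square)
    also have "n * B * t = g\<^sup>2" using g by (simp add: t_def)
    finally show ?thesis by (simp add: power_mult_distrib power_divide)
  qed
  moreover have "B * (x * q) \<noteq> D"
  proof
    assume "B * (x * q) = D"
    hence "x = z" using D pos zq by simp
    hence "8 * t * z = (z + q)\<^sup>2" using xt by simp
    hence "(7 * z - 5 * q)\<^sup>2 = 2 * (4 * q)\<^sup>2" unfolding t_def by algebra
    from rat_sqrt2_irrational[OF this] zq show False by simp
  qed
  ultimately show ?thesis using zq unfolding on_surface_def by (metis diff_gt_0_iff_gt)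
qed

lemma on_surface_avoid:
  assumes pos: "B > 0" "D > 0" "n > 0" and S: "on_surface B D n z q"
  shows "\<exists>x y. on_surface B D n x y \<and> B * (x * y) \<noteq> D"
proof (cases "B * (z * q) = D")
  case True
  obtain h where zq: "0 < q" "q < z" and h: "h\<^sup>2 = 2 * n * (z * q) * (z - q) * (B * (z * q) + D)"
    using S by (auto simp: on_surface_def)
  have D: "D = B * (z * q)" using True by simp
  have "h\<^sup>2 = (2 * (z * q))\<^sup>2 * (n * B * (z - q))" unfolding h D by algebra
  hence g: "(h / (2 * (z * q)))\<^sup>2 = n * B * (z - q)"
    using zq by (simp add: power_divide)
  show ?thesis
  proof (cases "z = 3 * q")
    case False
    thus ?thesis using surface_move[OF zq _ D pos(1) g] by blast
  next
    \<comment> \<open>The doubling fails here, so it starts from (2 q, 3 q / 2) instead. This point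
      has the same product z q, and its difference q / 2 is a quarter of the old difference 2 q, so
      the square condition survives.\<close>
    case True
    have "(h / (2 * (z * q)) / 2)\<^sup>2 = n * B * (z - q) / 4"
      using g by (simp add: power_divide)
    also have "\<dots> = n * B * (2 * q - 3 / 2 * q)" using True by simp
    finally have g': "(h / (2 * (z * q)) / 2)\<^sup>2 = n * B * (2 * q - 3 / 2 * q)" .
    have "D = B * (2 * q * (3 / 2 * q))" using D True by simp
    from surface_move[OF _ _ _ this pos(1) g'] zq show ?thesis by fastforce
  qed
qed (use S in blast)

section \<open>From surface points to solutions of the system\<close>

lemma frac_le_fracI:
  fixes a b c d :: "'a :: linordered_field"
  assumes "0 < b" "0 < d" "a * d \<le> c * b"
  shows "a / b \<le> c / d"
  using assms by (simp add: field_simps)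

text \<open>Inverting z = (x + D w) / (x - B w) and q = (u - D N) / (u + B N) gives \<open>x\<close>
  and \<open>u\<close>. The curves then ask for one slope a = y/x = v/u with a^2 = (B + D)^2 w f =
  (B + D)^2 N g, and the surface equation makes this value a square. The signs of \<open>z\<close>
  and \<open>q\<close> stay free so that mirror images are covered.\<close>

lemma solution_of_surface_point:
  fixes B D n z q h :: rat
  assumes pos: "B > 0" "D > 0" "n > 0"
    and h: "h\<^sup>2 = 2 * n * (z * q) * (z - q) * (B * (z * q) + D)"
    and F: "z / ((z - 1) * (B * z + D)) > 0"
    and G: "q / ((1 - q) * (B * q + D)) > 0"
    and le: "q / ((1 - q) * (B * q + D)) \<le> z / ((z - 1) * (B * z + D))"
  shows "\<exists>u v w x y. y * v \<noteq> 0 \<and> 0 < w \<and> w \<le> n \<and>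
      y\<^sup>2 = x * (x + D * w) * (x - B * w) \<and>
      v\<^sup>2 = u * (u - D * (2 * n - w)) * (u + B * (2 * n - w)) \<and> x * v = u * y"
proof -
  define f where "f = z / ((z - 1) * (B * z + D))"
  define g where "g = q / ((1 - q) * (B * q + D))"
  define P where "P = (z - q) * (B * (z * q) + D)"
  \<comment> \<open>The slope \<open>a\<close> is a square root of 2 n z q (B + D)^2 / P, because
    h^2 = 2 n z q P.\<close>
  define a where "a = h * (B + D) / P"
  \<comment> \<open>\<open>w\<close> and \<open>N\<close> solve w + N = 2 n and w f = N g, so w
    \<le> N is equivalent to g \<le> f.\<close>
  define w where "w = 2 * n * g / (f + g)"
  define N where "N = 2 * n * f / (f + g)"
  define x where "x = w * (B * z + D) / (z - 1)"
  define u where "u = N * (B * q + D) / (1 - q)"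
  have fg: "f > 0" "g > 0" "g \<le> f" using F G le by (simp_all add: f_def g_def)
  have nz: "z \<noteq> 0" "z - 1 \<noteq> 0" "B * z + D \<noteq> 0" "q \<noteq> 0" "1 - q \<noteq> 0" "B * q + D \<noteq> 0"
    using F G by auto
  have fz: "f * ((z - 1) * (B * z + D)) = z" using nz by (simp add: f_def)
  have gq: "g * ((1 - q) * (B * q + D)) = q" using nz by (simp add: g_def)
  have FG: "(f + g) * (((z - 1) * (B * z + D)) * ((1 - q) * (B * q + D))) = P"
  proof -
    have "(f + g) * (s * t) = (f * s) * t + (g * t) * s" for s t by algebra
    hence "(f + g) * (((z - 1) * (B * z + D)) * ((1 - q) * (B * q + D)))
        = z * ((1 - q) * (B * q + D)) + q * ((z - 1) * (B * z + D))"
      by (simp only: fz gq)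
    thus ?thesis unfolding P_def by algebra
  qed
  hence P: "P \<noteq> 0" using fg nz by auto
  have prod: "f * g * P = z * q * (f + g)"
  proof -
    have "f * g * ((f + g) * (s * t)) = (f * s) * (g * t) * (f + g)" for s t by algebra
    thus ?thesis unfolding FG[symmetric] by (simp only: fz gq)
  qed
  have w: "w > 0" "N > 0" using fg pos by (simp_all add: w_def N_def)
  have N: "2 * n - w = N" using fg by (simp add: w_def N_def field_simps)
  have "w \<le> N" unfolding w_def N_def using fg pos by (intro divide_right_mono) auto
  hence wn: "w \<le> n" using N by linarith
  have "h\<^sup>2 = 2 * n * (z * q) * P" unfolding h P_def by algebra
  hence aa: "a\<^sup>2 = 2 * n * (z * q) * (B + D)\<^sup>2 / P"
    unfolding a_def power_divide power_mult_distrib using P by (simp add: power2_eq_square)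
  have fgP: "f * g / (f + g) = z * q / P" using prod P fg by (simp add: field_simps)
  have a1: "a\<^sup>2 = w * (B + D)\<^sup>2 * f"
  proof -
    have "w * (B + D)\<^sup>2 * f = 2 * n * (B + D)\<^sup>2 * (f * g / (f + g))" by (simp add: w_def)
    thus ?thesis unfolding fgP aa by simp
  qed
  have a2: "a\<^sup>2 = N * (B + D)\<^sup>2 * g"
  proof -
    have "N * (B + D)\<^sup>2 * g = 2 * n * (B + D)\<^sup>2 * (f * g / (f + g))" by (simp add: N_def)
    thus ?thesis unfolding fgP aa by simp
  qed
  have "a\<^sup>2 > 0" unfolding a1 using w fg pos by simp
  hence a: "a \<noteq> 0" by auto
  have x: "x * (z - 1) = w * (B * z + D)" using nz by (simp add: x_def)
  have u: "u * (1 - q) = N * (B * q + D)" using nz by (simp add: u_def)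
  have xu: "x \<noteq> 0" "u \<noteq> 0" using w nz by (auto simp: x_def u_def)
  have "(z - 1)\<^sup>2 * ((a * x)\<^sup>2 - x * (x + D * w) * (x - B * w)) = 0"
  proof -
    have 1: "(z - 1) * (x + D * w) = w * z * (B + D)" using x by algebra
    have 2: "(z - 1) * (x - B * w) = w * (B + D)" using x by algebra
    have 3: "f * (z - 1)\<^sup>2 * x = w * z" using x fz by algebra
    have "(z - 1)\<^sup>2 * (a * x)\<^sup>2 = w * (B + D)\<^sup>2 * x * (f * (z - 1)\<^sup>2 * x)"
      using a1 by algebra
    also have "\<dots> = x * ((z - 1) * (x + D * w)) * ((z - 1) * (x - B * w))"
      unfolding 1 2 3 by algebra
    finally show ?thesis by algebra
  qed
  hence E: "(a * x)\<^sup>2 = x * (x + D * w) * (x - B * w)" using nz by simp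
  have "(1 - q)\<^sup>2 * ((a * u)\<^sup>2 - u * (u - D * N) * (u + B * N)) = 0"
  proof -
    have 1: "(1 - q) * (u - D * N) = N * q * (B + D)" using u by algebra
    have 2: "(1 - q) * (u + B * N) = N * (B + D)" using u by algebra
    have 3: "g * (1 - q)\<^sup>2 * u = N * q" using u gq by algebra
    have "(1 - q)\<^sup>2 * (a * u)\<^sup>2 = N * (B + D)\<^sup>2 * u * (g * (1 - q)\<^sup>2 * u)"
      using a2 by algebra
    also have "\<dots> = u * ((1 - q) * (u - D * N)) * ((1 - q) * (u + B * N))"
      unfolding 1 2 3 by algebra
    finally show ?thesis by algebra
  qed
  hence F: "(a * u)\<^sup>2 = u * (u - D * N) * (u + B * N)" using nz by simp
  show ?thesis
    by (rule exI[of _ u], rule exI[of _ "a * u"], rule exI[of _ w], rule exI[of _ x], rule exI[of _ "a * x"])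
       (use E F N w wn a xu in auto)
qed

lemma solution_exists:
  fixes B D n :: rat
  assumes pos: "B > 0" "D > 0" "n > 0" and S0: "on_surface B D n z0 q0"
  shows "\<exists>u v w x y. y * v \<noteq> 0 \<and> 0 < w \<and> w \<le> n \<and>
      y\<^sup>2 = x * (x + D * w) * (x - B * w) \<and>
      v\<^sup>2 = u * (u - D * (2 * n - w)) * (u + B * (2 * n - w)) \<and> x * v = u * y"
proof -
  obtain z1 q1 where S1: "on_surface B D n z1 q1" "B * (z1 * q1) \<noteq> D"
    using on_surface_avoid[OF pos S0] by blast
  define p where "p = z1 * q1"
  have p: "p > 0" using S1 by (auto simp: p_def on_surface_def)
  have pne: "D - B * p \<noteq> 0" using S1 by (simp add: p_def)
  \<comment> \<open>The summands ensure in turn z > 1, q < 1, B z > D, B q < D, and finally the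
    inequality behind w \<le> n. The last one uses D + B, not D - B, to be positive in every
    case.\<close>
  define M where "M = 1 + p + D / B + B * p / D + 2 * (D + B) * p / \<bar>D - B * p\<bar>"
  obtain z where zM: "z > M" and S: "on_surface B D n z (p / z)"
    using on_surface_unbounded[OF pos S1(1)] unfolding p_def by blast
  have t: "p > 0" "D / B > 0" "B * p / D > 0" "2 * (D + B) * p / \<bar>D - B * p\<bar> > 0"
    using p pos pne by simp_all
  hence z: "z > 1" "z > p" "z > D / B" "z > B * p / D" "z > 2 * (D + B) * p / \<bar>D - B * p\<bar>"
    using zM unfolding M_def by linarith+
  define q where "q = p / z"
  have zq: "z * q = p" using z by (simp add: q_def)
  obtain h where q: "0 < q" "q < z" and h: "h\<^sup>2 = 2 * n * (z * q) * (z - q) * (B * (z * q) + D)"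
    using S unfolding q_def by (auto simp: on_surface_def)
  have "2 * (D + B) * p < z * \<bar>D - B * p\<bar>" using z(5) pne by (simp add: pos_divide_less_eq)
  also have "\<dots> \<le> (z + q) * \<bar>D - B * p\<bar>" using q by (intro mult_right_mono) auto
  finally have big: "2 * (D + B) * p < (z + q) * \<bar>D - B * p\<bar>" .
  have "2 * (D - B) * p \<le> 2 * (D + B) * p" using pos p by (intro mult_right_mono) auto
  hence big: "2 * (D - B) * p \<le> (z + q) * \<bar>D - B * p\<bar>" using big by linarith
  have q1: "q < 1" using z by (simp add: q_def)
  have Bz: "B * z > D" using z(3) pos by (simp add: pos_divide_less_eq mult.commute)
  have Bq: "B * q < D" using z pos by (simp add: q_def pos_divide_less_eq mult.commute)
  show ?thesis
  proof (cases "B * p < D")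
    case True
    have A: "(z - 1) * (B * z + D) > 0" "(1 - q) * (B * q + D) > 0"
      using z q q1 pos by (simp_all add: add_pos_pos)
    \<comment> \<open>This is the desired inequality of fractions, cross-multiplied and
      expanded.\<close>
    have "2 * (D - B) * (z * q) \<le> (z + q) * (D - B * (z * q))" using big True zq by simp
    hence "q * ((z - 1) * (B * z + D)) \<le> z * ((1 - q) * (B * q + D))"
      by (simp add: algebra_simps)
    hence "q / ((1 - q) * (B * q + D)) \<le> z / ((z - 1) * (B * z + D))"
      by (rule frac_le_fracI[OF A(2,1)])
    thus ?thesis using z(1) q A by (intro solution_of_surface_point[OF pos h]) simp_all
  next
    case False
    have A: "(1 + q) * (D - B * q) > 0" "(1 + z) * (B * z - D) > 0"
      using z q Bz Bq by simp_all
    \<comment> \<open>Passing to (-q, -z) preserves both the product z q and the difference z -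
      q.\<close>
    have h': "h\<^sup>2 = 2 * n * (- q * - z) * (- q - - z) * (B * (- q * - z) + D)"
      using h by (simp add: mult.commute)
    have e: "- q / ((- q - 1) * (B * - q + D)) = q / ((1 + q) * (D - B * q))"
      "- z / ((1 - - z) * (B * - z + D)) = z / ((1 + z) * (B * z - D))"
      using A by (simp_all add: divide_simps) (simp_all add: algebra_simps)
    have "2 * (D - B) * (z * q) \<le> (z + q) * (B * (z * q) - D)" using big False zq by simp
    hence "z * ((1 + q) * (D - B * q)) \<le> q * ((1 + z) * (B * z - D))"
      by (simp add: algebra_simps)
    hence "z / ((1 + z) * (B * z - D)) \<le> q / ((1 + q) * (D - B * q))"
      by (rule frac_le_fracI[OF A(2,1)])
    thus ?thesis using z(1) q A by (intro solution_of_surface_point[OF pos h']) (simp_all only: e, simp_all)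
  qed
qed

section \<open>Triangles with a common side \<open>a\<close>\<close>

text \<open>The law of cosines factors as (t + b)(t - b) = 2 a X, and similarly for
  \<open>u\<close>. After substitution of the half-angle parameters, these factorizations and a (b +
  d) = R n make the radicand a perfect square.\<close>

lemma on_surface_of_cevian:
  fixes R S n a b c d e :: rat
  assumes R: "\<bar>S\<bar> < R" and pos: "a > 0" "b > 0" "c > 0" "d > 0" "e > 0"
    and c: "a\<^sup>2 + b\<^sup>2 - (2 * S / R) * a * b = c\<^sup>2"
    and e: "a\<^sup>2 + d\<^sup>2 + (2 * S / R) * a * d = e\<^sup>2"
    and n: "a * (b + d) = R * n"
  shows "\<exists>z q. on_surface (R - S) (R + S) n z q"
proof -
  define k where "k = S / R"
  have R0: "R > 0" and S: "S = k * R" and k: "- 1 < k" "k < 1"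
    using R by (auto simp: k_def divide_simps split: if_splits)
  have c: "c\<^sup>2 = a\<^sup>2 + b\<^sup>2 - 2 * k * a * b" using c by (simp add: k_def)
  have e: "e\<^sup>2 = a\<^sup>2 + d\<^sup>2 + 2 * k * a * d" using e by (simp add: k_def)
  define t where "t = a + c"
  define u where "u = a + e"
  \<comment> \<open>Strict triangle inequalities from |k| < 1; they keep the denominator of
    \<open>z\<close> and the numerator of \<open>q\<close> positive.\<close>
  have "k * (a * b) < 1 * (a * b)" "-1 * (a * d) < k * (a * d)"
    using k pos by (intro mult_strict_right_mono; simp)+
  hence "(b - a)\<^sup>2 < c\<^sup>2" "(d - a)\<^sup>2 < e\<^sup>2" unfolding c e by (simp_all add: power2_eq_square algebra_simps)
  hence "b - a < c" "d - a < e" using pos by (auto intro: power2_less_imp_less)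
  hence tu: "t - b > 0" "u - d > 0" by (simp_all add: t_def u_def)
  define X where "X = t - k * b"
  define Y where "Y = u + k * d"
  have t2: "(t + b) * (t - b) = 2 * a * X" using c unfolding t_def X_def by algebra
  have u2: "(u - d) * (u + d) = 2 * a * Y" using e unfolding u_def Y_def by algebra
  have main: "(t * d + u * b) * ((t * u - b * d) + k * (t * d - b * u)) = 2 * (a * (b + d)) * X * Y"
    using t2 u2 unfolding X_def Y_def by algebra
  define W where "W = (t - b) * (u + d)"
  have W: "W > 0" using tu pos by (simp add: W_def)
  define z where "z = (t + b) / (t - b)"
  define q where "q = (u - d) / (u + d)"
  have zq: "z * q = (t + b) * (u - d) / W" by (simp add: z_def q_def W_def)
  have z_q: "z - q = 2 * (t * d + u * b) / W"
    unfolding z_def q_def W_def using tu pos by (simp add: diff_frac_eq) (simp add: algebra_simps)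
  have BD: "(R - S) * (z * q) + (R + S) = 2 * R * ((t * u - b * d) + k * (t * d - b * u)) / W"
    unfolding zq S using W by (simp add: field_simps) (simp add: W_def algebra_simps)
  have "2 * n * (z * q) * (z - q) * ((R - S) * (z * q) + (R + S))
      = 2 * n * ((t + b) * (u - d) / W) * (2 * (t * d + u * b) / W)
        * (2 * R * ((t * u - b * d) + k * (t * d - b * u)) / W)"
    by (simp only: BD z_q) (simp only: zq)
  also have "\<dots> = 8 * n * R * ((t + b) * (u - d) * W)
      * ((t * d + u * b) * ((t * u - b * d) + k * (t * d - b * u))) / W ^ 4"
  proof -
    have "2 * n * (i / W) * (2 * j / W) * (2 * R * l / W) = 8 * n * R * (i * W) * (j * l) / W ^ 4" for i j l
      using W by (simp add: power4_eq_xxxx mult_ac)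
    thus ?thesis .
  qed
  also have "(t + b) * (u - d) * W = 2 * a * X * (2 * a * Y)"
    unfolding t2[symmetric] u2[symmetric] W_def by algebra
  also have "8 * n * R * (2 * a * X * (2 * a * Y))
      * ((t * d + u * b) * ((t * u - b * d) + k * (t * d - b * u))) = (8 * n * R * a * X * Y)\<^sup>2"
    unfolding main n by algebra
  also have "\<dots> / W ^ 4 = (8 * n * R * a * X * Y / W\<^sup>2)\<^sup>2"
    by (simp add: power_divide flip: power_mult)
  finally have "(8 * n * R * a * X * Y / W\<^sup>2)\<^sup>2
      = 2 * n * (z * q) * (z - q) * ((R - S) * (z * q) + (R + S))" ..
  moreover have "q > 0" using tu pos by (simp add: q_def)
  moreover have "z - q > 0" unfolding z_q using tu pos W by (simp add: add_pos_pos)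
  ultimately show ?thesis unfolding on_surface_def by (metis diff_gt_0_iff_gt)
qed

text \<open>Dividing the curve equation by \<open>x\<close> gives 4 a^2 x = x^2 + 2 S w x - P. With
  b = R w / (2 a), the law of cosines then reduces to (x^2 - P)^2 + 4 x^2 P = (x^2 + P)^2, which
  yields \<open>c\<close>.\<close>

lemma cevian_side:
  fixes R S w x y :: rat
  assumes R: "\<bar>S\<bar> < R" and w: "w > 0" and y: "y \<noteq> 0"
    and E: "y\<^sup>2 = x * (x + (R + S) * w) * (x - (R - S) * w)" and a: "a = \<bar>y / x\<bar> / 2"
  shows "\<exists>b c. b > 0 \<and> c > 0 \<and> a\<^sup>2 + b\<^sup>2 - (2 * S / R) * a * b = c\<^sup>2 \<and> 2 * a * b = R * w"
proof -
  have x: "x \<noteq> 0" using E y by auto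
  have R0: "R > 0" using R by linarith
  have a0: "a > 0" using x y by (simp add: a)
  define b where "b = R * w / (2 * a)"
  have b: "b > 0" using R0 w a0 by (simp add: b_def)
  have ab: "2 * a * b = R * w" using a0 by (simp add: b_def)
  define P where "P = (R\<^sup>2 - S\<^sup>2) * w\<^sup>2"
  have "S\<^sup>2 < R\<^sup>2" using R by (metis abs_ge_zero power2_abs power_strict_mono zero_less_numeral)
  hence P: "P > 0" using w by (simp add: P_def)
  have a2: "4 * x\<^sup>2 * a\<^sup>2 = y\<^sup>2" using x by (simp add: a power_divide power_mult_distrib)
  have axx: "4 * a\<^sup>2 * x = x\<^sup>2 + 2 * S * w * x - P"
  proof -
    have "x * (4 * a\<^sup>2 * x) = x * (x\<^sup>2 + 2 * S * w * x - P)" using a2 E unfolding P_def by algebra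
    thus ?thesis using x by simp
  qed
  define c where "c = (x\<^sup>2 + P) / (4 * a * \<bar>x\<bar>)"
  have c: "c > 0" using P a0 x by (simp add: c_def add_nonneg_pos)
  have "(4 * a * x)\<^sup>2 * (a\<^sup>2 + b\<^sup>2 - S * w) = (x\<^sup>2 + P)\<^sup>2"
  proof -
    have "(4 * a * x)\<^sup>2 * (a\<^sup>2 + b\<^sup>2 - S * w)
        = (4 * a\<^sup>2 * x)\<^sup>2 + 4 * x\<^sup>2 * (2 * a * b)\<^sup>2 - 4 * (4 * a\<^sup>2 * x) * x * (S * w)" by algebra
    also have "\<dots> = (x\<^sup>2 + P)\<^sup>2" unfolding axx ab P_def by algebra
    finally show ?thesis .
  qed
  hence "a\<^sup>2 + b\<^sup>2 - S * w = c\<^sup>2"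
    using a0 x by (simp add: c_def power_divide power_mult_distrib field_simps)
  moreover have "(2 * S / R) * a * b = S * w"
  proof -
    have "(2 * S / R) * a * b = S / R * (2 * a * b)" by simp
    thus ?thesis unfolding ab using R0 by simp
  qed
  ultimately show ?thesis using b c ab by metis
qed

theorem theorem3p1:
  fixes r s :: int and \<theta> :: real and n :: nat
  assumes "0 < \<theta>" and "\<theta> < pi" and "cos \<theta> = real_of_int s / real_of_int r"
    and "0 \<le> \<bar>s\<bar>" and "\<bar>s\<bar> < r" and "gcd r s = 1"
  shows "n \<in> N_theta r s \<longleftrightarrow>
    (\<exists>u v w x y :: rat. y * v \<noteq> 0 \<and> 0 < w \<and> w \<le> of_nat n \<and>
      y^2 = x * (x + of_int (r + s) * w) * (x - of_int (r - s) * w) \<and>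
      v^2 = u * (u - of_int (r + s) * (2 * of_nat n - w)) * (u + of_int (r - s) * (2 * of_nat n - w)) \<and>
      x * v = u * y)"
    (is "_ \<longleftrightarrow> ?rhs")
proof -
  define R S :: rat where "R = of_int r" and "S = of_int s"
  have RS: "\<bar>S\<bar> < R" using assms(5) unfolding R_def S_def by (metis of_int_abs of_int_less_iff)
  hence R0: "R > 0" "R + S > 0" "R - S > 0" by linarith+
  have rs: "of_int (r + s) = R + S" "of_int (r - s) = R - S" by (simp_all add: R_def S_def)
  show ?thesis
  proof
    assume "n \<in> N_theta r s"
    then obtain a b c d e :: rat where *: "a > 0" "b > 0" "c > 0" "d > 0" "e > 0"
      "a\<^sup>2 + b\<^sup>2 - (2 * S / R) * a * b = c\<^sup>2" "a\<^sup>2 + d\<^sup>2 + (2 * S / R) * a * d = e\<^sup>2"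
      "a * (b + d) = R * of_nat n"
      unfolding N_theta_def R_def S_def by blast
    \<comment> \<open>Membership forces n > 0, as \<open>solution_exists\<close> requires.\<close>
    have "a * (b + d) > 0" using *(1-5) by simp
    hence "R * of_nat n > 0" unfolding *(8) .
    hence "(of_nat n :: rat) > 0" using R0 by (simp add: zero_less_mult_iff)
    thus ?rhs unfolding rs
      using on_surface_of_cevian[OF RS *] solution_exists[OF R0(3,2)] by blast
  next
    assume ?rhs
    then obtain u v w x y :: rat where *: "y \<noteq> 0" "v \<noteq> 0" "0 < w" "w \<le> of_nat n"
      "y\<^sup>2 = x * (x + (R + S) * w) * (x - (R - S) * w)"
      "v\<^sup>2 = u * (u - (R + S) * (2 * of_nat n - w)) * (u + (R - S) * (2 * of_nat n - w))"
      "x * v = u * y"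
      unfolding rs by auto
    define N where "N = 2 * of_nat n - w"
    define a where "a = \<bar>y / x\<bar> / 2"
    have "x \<noteq> 0" "u \<noteq> 0" using *(1,2,5,6) by auto
    hence "y / x = v / u" using *(7) by (simp add: field_simps)
    hence a: "a = \<bar>v / u\<bar> / 2" "a > 0" using *(1,2) \<open>x \<noteq> 0\<close> \<open>u \<noteq> 0\<close> by (auto simp: a_def)
    have N: "N > 0" using *(3,4) by (simp add: N_def)
    obtain b c where bc: "b > 0" "c > 0" "a\<^sup>2 + b\<^sup>2 - (2 * S / R) * a * b = c\<^sup>2" "2 * a * b = R * w"
      using cevian_side[OF RS *(3,1,5) a_def] by blast
    \<comment> \<open>The second curve is the first with \<open>S\<close> negated, matching the
      supplementary angle \<pi> - \<theta>, so \<open>cevian_side\<close> applies again.\<close>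
    have F: "v\<^sup>2 = u * (u + (R + - S) * N) * (u - (R - - S) * N)"
      using *(6) unfolding N_def by algebra
    have "\<bar>- S\<bar> < R" using RS by simp
    from cevian_side[OF this N *(2) F a(1)] obtain d e where
      de: "d > 0" "e > 0" "a\<^sup>2 + d\<^sup>2 + (2 * S / R) * a * d = e\<^sup>2" "2 * a * d = R * N" by auto
    have "2 * (a * (b + d)) = 2 * (R * of_nat n)"
      using bc(4) de(4) unfolding N_def by algebra
    hence "a * (b + d) = R * of_nat n" by simp
    with a bc de show "n \<in> N_theta r s"
      unfolding N_theta_def R_def S_def by blast
  qed
qed
end
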